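(* Let $X$ and $Y$ be Banach spaces, and let $S\in L(X,Y)$ and $T\in L(Y,X)$ be regular operators such that $R(ST)\subseteq Y$ and $R(TS)\subseteq X$ are finite dimensional. Let $\mathcal{X}=X/R(TS)$, $\mathcal{Y}=Y/R(ST)$, and let $\tilde S\in L(\mathcal{X},\mathcal{Y})$, $\tilde T\in L(\mathcal{Y},\mathcal{X})$ be the operators induced by $S$ and $T$. Let $\tilde S'\in L(\mathcal{Y},\mathcal{X})$ and $\tilde T'\in L(\mathcal{X},\mathcal{Y})$ be generalized inverses of $\tilde S$ and $\tilde T$ respectively, and let $S'\in L(Y,X)$ and $T'\in L(X,Y)$ be any extensions of $\tilde S'$ and $\tilde T'$ respectively (as described in the context). Define $V\in L(X\oplus Y)$ by $V|_X=S+T'\in L(X,Y)$ and $V|_Y=T+S'\in L(Y,X)$. Then the following statements are equivalent: (i) $(S,T)$ is a regular Fredholm pair. (ii) $S'S+TT'\in L(X)$ and $T'T+SS'\in L(Y)$ are Fredholm operators. (iii) $V$ is a Fredholm operator.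
   Context: $L(X,Y)$ denotes the bounded linear operators from $X$ to $Y$, and $L(X)=L(X,X)$; $N(\cdot)$ and $R(\cdot)$ denote null space and range. An operator $A\in L(X,Y)$ is regular if there is $B\in L(Y,X)$ with $A=ABA$; such a $B$ is called a generalized inverse of $A$. Fredholm pairs: for $S\in L(X,Y)$ and $T\in L(Y,X)$, the pair $(S,T)$ is a Fredholm pair if the following dimensions are finite: $\dim N(S)/(N(S)\cap R(T))$, $\dim R(T)/(N(S)\cap R(T))$, $\dim N(T)/(N(T)\cap R(S))$, $\dim R(S)/(N(T)\cap R(S))$. A Fredholm pair $(S,T)$ is a regular Fredholm pair if $S$ and $T$ are regular operators. Induced operators: with $\pi_X\colon X\to\mathcal{X}$ and $\pi_Y\colon Y\to\mathcal{Y}$ the quotient maps, $\tilde S$ and $\tilde T$ are determined by $\tilde S\pi_X=\pi_Y S$ and $\tilde T\pi_Y=\pi_X T$. When $S$ and $T$ are regular, so are $\tilde S$ and $\tilde T$. Extensions: fix closed subspaces $X_0\subseteq X$ and $Y_0\subseteq Y$ with $X=R(TS)\oplus X_0$ and $Y=R(ST)\oplus Y_0$. Then $\pi_X|_{X_0}\colon X_0\to\mathcal{X}$ and $\pi_Y|_{Y_0}\colon Y_0\to\mathcal{Y}$ are isomorphisms, by means of which $\tilde S'$ and $\tilde T'$ are viewed as operators $Y_0\to X_0$ and $X_0\to Y_0$. An extension of $\tilde S'$ is any $S'\in L(Y,X)$ with $S'|_{Y_0}=(\pi_X|_{X_0})^{-1}\tilde S'\,\pi_Y|_{Y_0}$,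 and an extension of $\tilde T'$ is any $T'\in L(X,Y)$ with $T'|_{X_0}=(\pi_Y|_{Y_0})^{-1}\tilde T'\,\pi_X|_{X_0}$.
   Formalization: The equivalence with (iii) is proved only when the generalized inverses are also reflexive (S̃'S̃S̃'=S̃', T̃'T̃T̃'=T̃'); without this it fails, e.g. X=Y infinite dimensional, S=T=0, S'=T'=id. (i)⇔(ii) is proved as stated. *)

theory Defs
  imports "HOL-Analysis.Analysis"
begin

(* Banach spaces over the scalar field 'k. A real_normed_field is, up to isomorphism, the real
   or the complex numbers, so both kinds of Banach space are covered. The class banach supplies
   the underlying real Banach space, with which the scalar multiplication has to agree. *)
locale banach_space_over = vector_space scale
  for scale :: "'k::real_normed_field \<Rightarrow> 'a::banach \<Rightarrow> 'a" +
  assumes scale_of_real: "scale (of_real r) x = r *\<^sub>R x"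
    and norm_scale: "norm (scale c x) = norm c * norm x"

definition bounded_ops ::
    "('k \<Rightarrow> 'a \<Rightarrow> 'a) \<Rightarrow> ('k \<Rightarrow> 'b \<Rightarrow> 'b) \<Rightarrow> ('a::real_normed_vector \<Rightarrow> 'b::real_normed_vector) set"
  where "bounded_ops sX sY = {A. bounded_linear A \<and> (\<forall>c x. A (sX c x) = sY c (A x))}"

definition null_space :: "('a \<Rightarrow> 'b::zero) \<Rightarrow> 'a set"
  where "null_space A = {x. A x = 0}"

definition generalized_inverse ::
    "('k \<Rightarrow> 'a \<Rightarrow> 'a) \<Rightarrow> ('k \<Rightarrow> 'b \<Rightarrow> 'b) \<Rightarrow>
     ('a::real_normed_vector \<Rightarrow> 'b::real_normed_vector) \<Rightarrow> ('b \<Rightarrow> 'a) \<Rightarrow> bool"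
  where "generalized_inverse sX sY A B \<longleftrightarrow> B \<in> bounded_ops sY sX \<and> A = A \<circ> B \<circ> A"

definition regular_op ::
    "('k \<Rightarrow> 'a \<Rightarrow> 'a) \<Rightarrow> ('k \<Rightarrow> 'b \<Rightarrow> 'b) \<Rightarrow>
     ('a::real_normed_vector \<Rightarrow> 'b::real_normed_vector) \<Rightarrow> bool"
  where "regular_op sX sY A \<longleftrightarrow>
    A \<in> bounded_ops sX sY \<and> (\<exists>B. generalized_inverse sX sY A B)"


(* Quotients are sets of cosets: an element of N/M is x +o M = {x + m | m. m \<in> M}, and the
   quotient map X \<rightarrow> X/M is \<lambda>x. x +o M. Cosets are added by the set addition of Set_Algebras.
   Adding M in coset_scale makes 0 \<cdot> (x + M) = M; for c \<noteq> 0 it changes nothing. *)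
definition quotient_space :: "'a::plus set \<Rightarrow> 'a set \<Rightarrow> 'a set set"
  where "quotient_space N M = (\<lambda>x. x +o M) ` N"

definition coset_scale ::
    "('k \<Rightarrow> 'a \<Rightarrow> 'a) \<Rightarrow> 'a::plus set \<Rightarrow> 'k \<Rightarrow> 'a set \<Rightarrow> 'a set"
  where "coset_scale s M c C = s c ` C + M"

definition coset_norm :: "'a::real_normed_vector set \<Rightarrow> real"
  where "coset_norm C = (INF x\<in>C. norm x)"

(* Bounded linear operators X/M \<rightarrow> Y/N; their values outside X/M are irrelevant. *)
definition bounded_quotient_ops ::
    "('k \<Rightarrow> 'a \<Rightarrow> 'a) \<Rightarrow> 'a::real_normed_vector set \<Rightarrow>
     ('k \<Rightarrow> 'b \<Rightarrow> 'b) \<Rightarrow> 'b::real_normed_vector set \<Rightarrow> ('a set \<Rightarrow> 'b set) set"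
  where "bounded_quotient_ops sX M sY N = {F.
    (\<forall>C\<in>quotient_space UNIV M. F C \<in> quotient_space UNIV N) \<and>
    (\<forall>C\<in>quotient_space UNIV M. \<forall>D\<in>quotient_space UNIV M. F (C + D) = F C + F D) \<and>
    (\<forall>c. \<forall>C\<in>quotient_space UNIV M. F (coset_scale sX M c C) = coset_scale sY N c (F C)) \<and>
    (\<exists>K. \<forall>C\<in>quotient_space UNIV M. coset_norm (F C) \<le> K * coset_norm C)}"

(* As for operators on X and Y, F = FGF alone does not imply G = GFG. Requiring the relation for
   (F, G) and for (G, F) makes G a reflexive (normalized) generalized inverse. This matters for
   the operator V. For S = T = 0 and X = Y, the identity is a generalized inverse of 0, which
   makes V(x, y) = (y, x) invertible, whereas (0, 0) is a Fredholm pair only if dim X is finite. *)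
definition quotient_generalized_inverse ::
    "('k \<Rightarrow> 'a \<Rightarrow> 'a) \<Rightarrow> 'a::real_normed_vector set \<Rightarrow>
     ('k \<Rightarrow> 'b \<Rightarrow> 'b) \<Rightarrow> 'b::real_normed_vector set \<Rightarrow>
     ('a set \<Rightarrow> 'b set) \<Rightarrow> ('b set \<Rightarrow> 'a set) \<Rightarrow> bool"
  where "quotient_generalized_inverse sX M sY N F G \<longleftrightarrow>
    G \<in> bounded_quotient_ops sY N sX M \<and> (\<forall>C\<in>quotient_space UNIV M. F C = F (G (F C)))"

definition induced_op ::
    "('k \<Rightarrow> 'a \<Rightarrow> 'a) \<Rightarrow> 'a::real_normed_vector set \<Rightarrow>
     ('k \<Rightarrow> 'b \<Rightarrow> 'b) \<Rightarrow> 'b::real_normed_vector set \<Rightarrow>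
     ('a \<Rightarrow> 'b) \<Rightarrow> ('a set \<Rightarrow> 'b set) \<Rightarrow> bool"
  where "induced_op sX M sY N A F \<longleftrightarrow>
    F \<in> bounded_quotient_ops sX M sY N \<and> (\<forall>x. F (x +o M) = A x +o N)"


definition fin_dim :: "('k::field \<Rightarrow> 'a \<Rightarrow> 'a) \<Rightarrow> 'a::ab_group_add set \<Rightarrow> bool"
  where "fin_dim s W \<longleftrightarrow> (\<exists>B. finite B \<and> W = module.span s B)"

(* dim N/M is finite, for subspaces M \<subseteq> N: the cosets of finitely many elements of N span N/M. *)
definition fin_dim_quotient ::
    "('k::field \<Rightarrow> 'a \<Rightarrow> 'a) \<Rightarrow> 'a::ab_group_add set \<Rightarrow> 'a set \<Rightarrow> bool"
  where "fin_dim_quotient s N M \<longleftrightarrow>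
    (\<exists>B. finite B \<and> B \<subseteq> N \<and> quotient_space N M = quotient_space (module.span s B) M)"

definition fredholm_op ::
    "('k::field \<Rightarrow> 'a \<Rightarrow> 'a) \<Rightarrow> ('a::real_normed_vector \<Rightarrow> 'a) \<Rightarrow> bool"
  where "fredholm_op s A \<longleftrightarrow>
    A \<in> bounded_ops s s \<and> fin_dim s (null_space A) \<and> fin_dim_quotient s UNIV (range A)"

definition fredholm_pair ::
    "('k::field \<Rightarrow> 'a \<Rightarrow> 'a) \<Rightarrow> ('k \<Rightarrow> 'b \<Rightarrow> 'b) \<Rightarrow>
     ('a::real_normed_vector \<Rightarrow> 'b::real_normed_vector) \<Rightarrow> ('b \<Rightarrow> 'a) \<Rightarrow> bool"
  where "fredholm_pair sX sY S T \<longleftrightarrow>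
    S \<in> bounded_ops sX sY \<and> T \<in> bounded_ops sY sX \<and>
    fin_dim_quotient sX (null_space S) (null_space S \<inter> range T) \<and>
    fin_dim_quotient sX (range T) (null_space S \<inter> range T) \<and>
    fin_dim_quotient sY (null_space T) (null_space T \<inter> range S) \<and>
    fin_dim_quotient sY (range S) (null_space T \<inter> range S)"

definition regular_fredholm_pair ::
    "('k::field \<Rightarrow> 'a \<Rightarrow> 'a) \<Rightarrow> ('k \<Rightarrow> 'b \<Rightarrow> 'b) \<Rightarrow>
     ('a::real_normed_vector \<Rightarrow> 'b::real_normed_vector) \<Rightarrow> ('b \<Rightarrow> 'a) \<Rightarrow> bool"
  where "regular_fredholm_pair sX sY S T \<longleftrightarrow>
    fredholm_pair sX sY S T \<and> regular_op sX sY S \<and> regular_op sY sX T"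


definition closed_complement ::
    "('k::field \<Rightarrow> 'a \<Rightarrow> 'a) \<Rightarrow> 'a::real_normed_vector set \<Rightarrow> 'a set \<Rightarrow> bool"
  where "closed_complement s M X0 \<longleftrightarrow>
    module.subspace s X0 \<and> closed X0 \<and> M + X0 = UNIV \<and> M \<inter> X0 = {0}"

(* A' is an extension of G : Y/N \<rightarrow> X/M relative to the closed complements X0 of M and Y0 of N;
   inv_into X0 (\<lambda>x. x +o M) is the inverse of the isomorphism X0 \<rightarrow> X/M. *)
definition extension_of ::
    "('k \<Rightarrow> 'a \<Rightarrow> 'a) \<Rightarrow> 'a::real_normed_vector set \<Rightarrow> 'a set \<Rightarrow>
     ('k \<Rightarrow> 'b \<Rightarrow> 'b) \<Rightarrow> 'b::real_normed_vector set \<Rightarrow> 'b set \<Rightarrow>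
     ('b set \<Rightarrow> 'a set) \<Rightarrow> ('b \<Rightarrow> 'a) \<Rightarrow> bool"
  where "extension_of sX M X0 sY N Y0 G A' \<longleftrightarrow>
    A' \<in> bounded_ops sY sX \<and>
    (\<forall>y\<in>Y0. A' y = inv_into X0 (\<lambda>x. x +o M) (G (y +o N)))"

end

theory Submission
  imports Defs
begin

text \<open>The equivalences are purely algebraic, because a Fredholm operator is defined here by the
  dimensions of its null space and of the quotient by its range. The hypotheses say that, up to
  operators of finite rank, \<open>ST = 0\<close>, \<open>TS = 0\<close>, \<open>SS'S = S\<close> and \<open>TT'T = T\<close>; in the reflexive case
  also \<open>S'SS' = S'\<close> and \<open>T'TT' = T'\<close>. The pair is Fredholm iff, up to finite dimension,
  \<open>N(S) \<subseteq> R(T)\<close> and \<open>N(T) \<subseteq> R(S)\<close>.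
  The operator \<open>A = S'S + TT'\<close> almost annihilates \<open>(1 - TT') N(S)\<close>, a complement of \<open>R(T)\<close> in
  \<open>N(S)\<close>, so that a finite-dimensional \<open>N(A)\<close> forces \<open>N(S) \<subseteq> R(T)\<close> up to finite dimension.
  Conversely, \<open>Ax = 0\<close> makes \<open>Sx\<close> and \<open>TT'x\<close> almost vanish, and \<open>Ty = A(Ty)\<close> and
  \<open>S'Sx = A(x - TT'x)\<close> up to finite rank, so that \<open>R(A)\<close> almost contains
  \<open>R(T) + R(S'S)\<close>, which is almost everything if \<open>N(S) \<subseteq> R(T)\<close>. In the reflexive case the same
  argument applies to \<open>S + T'\<close> and \<open>T + S'\<close>, the two blocks of \<open>V\<close>.\<close>

text \<open>Inclusion modulo finite dimension. The spanning set may lie anywhere in the ambient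
  space, so that transitivity and additivity only have to unite spanning sets. For
  \<open>M = {0}\<close> it says that \<open>N\<close> lies in a finite-dimensional subspace;
  applied to a range, this is finite rank.\<close>

definition almost_subset :: "('k::field \<Rightarrow> 'a \<Rightarrow> 'a) \<Rightarrow> 'a::ab_group_add set \<Rightarrow> 'a set \<Rightarrow> bool"
  where "almost_subset s N M \<longleftrightarrow> (\<exists>B. finite B \<and> N \<subseteq> M + module.span s B)"

section \<open>Calculus of inclusion modulo finite dimension\<close>

context vector_space
begin

lemma subspace_set_plus: "subspace M \<Longrightarrow> subspace N \<Longrightarrow> subspace (M + N)"
  using subspace_sums[of M N] by (simp add: set_plus_def Bex_def conj_commute conj_left_commute)

lemma almost_subset_mono:
  "almost_subset scale N M \<Longrightarrow> N' \<subseteq> N \<Longrightarrow> M \<subseteq> M' \<Longrightarrow> almost_subset scale N' M'"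
  unfolding almost_subset_def by (meson order_trans set_plus_mono2 order_refl)

lemma subset_imp_almost_subset:
  assumes "N \<subseteq> M"
  shows "almost_subset scale N M"
  unfolding almost_subset_def
  using assms by (intro exI[of _ "{}"]) (auto simp: set_plus_def)

lemma almost_subset_trans:
  assumes "almost_subset scale N M" "almost_subset scale M L"
  shows "almost_subset scale N L"
proof -
  obtain B C where B: "finite B" "N \<subseteq> M + span B" and C: "finite C" "M \<subseteq> L + span C"
    using assms unfolding almost_subset_def by blast
  have "M + span B \<subseteq> (L + span C) + span B"
    by (intro set_plus_mono2 C(2) order_refl)
  with B(2) have "N \<subseteq> L + (span C + span B)"
    by (simp add: add.assoc)
  also have "span C + span B = span (C \<union> B)"
    unfolding span_Un by (auto simp: set_plus_def)
  finally show ?thesis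
    unfolding almost_subset_def using B(1) C(1) by blast
qed

lemma almost_subset_set_plus:
  assumes "almost_subset scale N M" "almost_subset scale N' M'"
  shows "almost_subset scale (N + N') (M + M')"
proof -
  obtain B C where B: "finite B" "N \<subseteq> M + span B" and C: "finite C" "N' \<subseteq> M' + span C"
    using assms unfolding almost_subset_def by blast
  have "N + N' \<subseteq> (M + span B) + (M' + span C)"
    using B C by (intro set_plus_mono2)
  also have "\<dots> = (M + M') + (span B + span C)"
    by (simp add: ac_simps)
  also have "span B + span C = span (B \<union> C)"
    unfolding span_Un by (auto simp: set_plus_def)
  finally show ?thesis
    unfolding almost_subset_def using B(1) C(1) by blast
qed

lemma almost_subset_plus:
  assumes "subspace L" "almost_subset scale N L" "almost_subset scale N' L"
  shows "almost_subset scale (N + N') L"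
proof -
  have "L + L \<subseteq> L"
    using assms(1) by (auto simp: set_plus_def subspace_add)
  then show ?thesis
    using almost_subset_set_plus[OF assms(2,3)] almost_subset_mono by blast
qed

lemma almost_subset_zero_plus:
  assumes "almost_subset scale N {0}" "almost_subset scale N' {0}"
  shows "almost_subset scale (N + N') {0}"
  using almost_subset_plus[OF subspace_single_0 assms] .

text \<open>Serves identities that hold only up to a finite-rank error: the error set
  \<open>F\<close> is absorbed by the target subspace.\<close>

lemma almost_subset_zero_absorb:
  assumes "subspace L" "almost_subset scale F {0}" "N \<subseteq> L + F"
  shows "almost_subset scale N L"
proof (rule almost_subset_mono)
  have "almost_subset scale F L"
    by (rule almost_subset_mono[OF assms(2)]) (auto simp: subspace_0 assms(1))
  then show "almost_subset scale (L + F) L"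
    using almost_subset_plus[OF assms(1) subset_imp_almost_subset[OF order_refl]] by blast
qed (use assms(3) in auto)

end

section \<open>Images and preimages under linear maps\<close>

context Vector_Spaces.linear
begin

lemma almost_subset_image:
  assumes "almost_subset s1 N M"
  shows "almost_subset s2 (f ` N) (f ` M)"
proof -
  obtain B where B: "finite B" "N \<subseteq> M + vs1.span B"
    using assms unfolding almost_subset_def by blast
  have "f ` N \<subseteq> f ` M + vs2.span (f ` B)"
    using B(2) unfolding span_image by (fastforce simp: set_plus_def add)
  then show ?thesis
    unfolding almost_subset_def using B(1) by blast
qed

lemma almost_subset_image_zero:
  assumes "almost_subset s1 N {0}"
  shows "almost_subset s2 (f ` N) {0}"
  using almost_subset_image[OF assms] by (simp add: zero)

text \<open>Adding one spanning vector at a time: one element of \<open>N\<close> whose image needs the new vector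
  reduces all the others to the previous span.\<close>

lemma image_subset_imp_spanned_by_vimage:
  assumes "finite B" "vs1.subspace N" "vs2.subspace L" "f ` N \<subseteq> L + vs2.span B"
  shows "\<exists>C. finite C \<and> C \<subseteq> N \<and> N \<subseteq> {x \<in> N. f x \<in> L} + vs1.span C"
  using assms
proof (induction B arbitrary: N rule: finite_induct)
  case empty
  then show ?case
    by (intro exI[of _ "{}"]) (auto simp: set_plus_def)
next
  case (insert b B)
  let ?P = "L + vs2.span B"
  have P: "vs2.subspace ?P"
    using insert.prems by (intro vs2.subspace_set_plus) auto
  define N' where "N' = {x \<in> N. f x \<in> ?P}"
  have N': "vs1.subspace N'"
    using vs1.subspace_inter[OF insert.prems(1) subspace_vimage[OF P]]
    by (simp add: N'_def vimage_def Int_def)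
  obtain C where C: "finite C" "C \<subseteq> N'" "N' \<subseteq> {x \<in> N'. f x \<in> L} + vs1.span C"
    using insert.IH[OF N' insert.prems(2)] by (auto simp: N'_def)
  have coeff: "\<exists>c. f x - s2 c b \<in> ?P" if "x \<in> N" for x
  proof -
    obtain l w where lw: "l \<in> L" "w \<in> vs2.span (insert b B)" "f x = l + w"
      using insert.prems(3) \<open>x \<in> N\<close> by (fastforce elim: set_plus_elim)
    obtain c where "w - s2 c b \<in> vs2.span B"
      using lw(2) vs2.span_breakdown_eq by blast
    moreover have "f x - s2 c b = l + (w - s2 c b)"
      using lw(3) by simp
    ultimately show ?thesis
      using lw(1) by (metis set_plus_intro)
  qed
  show ?case
  proof (cases "N = N'")
    case True
    then show ?thesis using C by blast
  next
    case False
    then obtain x0 where x0: "x0 \<in> N" "f x0 \<notin> ?P"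
      by (auto simp: N'_def)
    obtain c0 where c0: "f x0 - s2 c0 b \<in> ?P"
      using coeff x0 by blast
    have "c0 \<noteq> 0"
      using c0 x0 by auto
    have "x \<in> {x \<in> N. f x \<in> L} + vs1.span (insert x0 C)" if "x \<in> N" for x
    proof -
      obtain c where c: "f x - s2 c b \<in> ?P"
        using coeff \<open>x \<in> N\<close> by blast
      \<comment> \<open>The vector \<open>b\<close> enters \<open>f x\<close> and
        \<open>f x0\<close> with coefficients \<open>c\<close> and \<open>c0\<close>, and
        \<open>c0\<close> is nonzero because \<open>f x0\<close> lies outside \<open>?P\<close>.
        Subtracting \<open>c / c0\<close> times \<open>x0\<close> cancels \<open>b\<close>, which
        puts \<open>?y\<close> into \<open>N'\<close>.\<close>
      let ?y = "x - s1 (c / c0) x0"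
      have "f ?y = (f x - s2 c b) - s2 (c / c0) (f x0 - s2 c0 b)"
        using \<open>c0 \<noteq> 0\<close> by (simp add: diff scale vs2.scale_right_diff_distrib)
      then have "f ?y \<in> ?P"
        using P c c0 by (simp add: vs2.subspace_diff vs2.subspace_scale)
      then have "?y \<in> N'"
        using \<open>x \<in> N\<close> x0 insert.prems(1) by (simp add: N'_def vs1.subspace_diff vs1.subspace_scale)
      then obtain z w where zw: "z \<in> N'" "f z \<in> L" "w \<in> vs1.span C" "?y = z + w"
        using C(3) by (fastforce elim: set_plus_elim)
      have "w + s1 (c / c0) x0 \<in> vs1.span (insert x0 C)"
        using zw(3) vs1.span_mono[of C "insert x0 C"]
        by (intro vs1.span_add[OF _ vs1.span_scale[OF vs1.span_base]]) auto
      moreover have x: "x = z + (w + s1 (c / c0) x0)"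
        using zw(4) by (simp add: algebra_simps)
      ultimately show ?thesis
        using zw(1,2) by (subst x) (auto simp: N'_def)
    qed
    then show ?thesis
      using C(1,2) x0(1) unfolding N'_def by (metis (no_types, lifting) finite_insert
          insert_subset mem_Collect_eq subset_iff)
  qed
qed

text \<open>For \<open>L = {0}\<close> this is rank-nullity: if \<open>f\<close> has finite rank on
  \<open>N\<close>, then \<open>N\<close> lies in the kernel of \<open>f\<close> up to finite
  dimension.\<close>

lemma almost_subset_vimage:
  assumes "vs1.subspace N" "vs2.subspace L" "almost_subset s2 (f ` N) L"
  shows "almost_subset s1 N {x \<in> N. f x \<in> L}"
proof -
  obtain B where "finite B" "f ` N \<subseteq> L + vs2.span B"
    using assms(3) unfolding almost_subset_def by blast
  from image_subset_imp_spanned_by_vimage[OF this(1) assms(1,2) this(2)] show ?thesis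
    unfolding almost_subset_def by blast
qed

end

section \<open>Finite-dimensional subspaces and quotients as inclusions modulo finite
  dimension\<close>

context vector_space
begin

lemma linear_ident: "Vector_Spaces.linear scale scale (\<lambda>x. x)"
  by unfold_locales auto

lemma almost_subset_Int:
  assumes "subspace N" "subspace L" "almost_subset scale N L"
  shows "almost_subset scale N (N \<inter> L)"
  using linear.almost_subset_vimage[OF linear_ident assms(1,2)] assms(3) by (simp add: Int_def)

text \<open>\<open>fin_dim_quotient\<close> asks for representatives inside \<open>N\<close>. The
  preimage argument for the identity map moves the spanning vectors there.\<close>

lemma almost_subset_spanned:
  assumes "subspace N" "subspace L" "almost_subset scale N L"
  obtains C where "finite C" "C \<subseteq> N" "N \<subseteq> L + span C"
proof -
  obtain B where B: "finite B" "(\<lambda>x. x) ` N \<subseteq> L + span B"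
    using assms(3) unfolding almost_subset_def by auto
  obtain C where "finite C" "C \<subseteq> N" "N \<subseteq> {x \<in> N. x \<in> L} + span C"
    using linear.image_subset_imp_spanned_by_vimage[OF linear_ident B(1) assms(1,2) B(2)] by blast
  moreover have "{x \<in> N. x \<in> L} + span C \<subseteq> L + span C"
    by (intro set_plus_mono2) auto
  ultimately show ?thesis
    using that by blast
qed

lemma fin_dim_iff_almost_subset:
  assumes "subspace W"
  shows "fin_dim scale W \<longleftrightarrow> almost_subset scale W {0}"
proof
  assume "fin_dim scale W"
  then show "almost_subset scale W {0}"
    unfolding fin_dim_def almost_subset_def by (auto simp: set_plus_def)
next
  assume "almost_subset scale W {0}"
  then obtain C where C: "finite C" "C \<subseteq> W" "W \<subseteq> {0} + span C"
    using almost_subset_spanned[OF assms subspace_single_0] by blast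
  then have "W = span C"
    using span_minimal[OF C(2) assms] by (auto simp: set_plus_def)
  then show "fin_dim scale W"
    unfolding fin_dim_def using C(1) by blast
qed

lemma coset_eq_iff:
  assumes "subspace M"
  shows "x +o M = y +o M \<longleftrightarrow> x - y \<in> M"
proof
  assume "x +o M = y +o M"
  then have "x + 0 \<in> y +o M"
    using subspace_0[OF assms] by blast
  then show "x - y \<in> M"
    by (auto simp: elt_set_plus_def)
next
  assume *: "x - y \<in> M"
  have "\<exists>m'\<in>M. x + m = y + m'" if "m \<in> M" for m
    using that * subspace_add[OF assms *] by (intro bexI[of _ "(x - y) + m"]) auto
  moreover have "\<exists>m'\<in>M. y + m = x + m'" if "m \<in> M" for m
    using that * subspace_diff[OF assms that *] by (intro bexI[of _ "m - (x - y)"]) auto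
  ultimately show "x +o M = y +o M"
    by (auto simp: elt_set_plus_def)
qed

lemma fin_dim_quotient_iff_almost_subset:
  assumes "subspace N" "subspace M"
  shows "fin_dim_quotient scale N M \<longleftrightarrow> almost_subset scale N M"
proof
  assume "fin_dim_quotient scale N M"
  then obtain B where B: "finite B" "quotient_space N M = quotient_space (span B) M"
    unfolding fin_dim_quotient_def by blast
  have "x \<in> M + span B" if "x \<in> N" for x
  proof -
    obtain w where "w \<in> span B" "x +o M = w +o M"
      using B(2) \<open>x \<in> N\<close> unfolding quotient_space_def by blast
    then show ?thesis
      unfolding coset_eq_iff[OF assms(2)] by (metis diff_add_cancel set_plus_intro)
  qed
  then show "almost_subset scale N M"
    unfolding almost_subset_def using B(1) by blast
next
  assume "almost_subset scale N M"
  then obtain C where C: "finite C" "C \<subseteq> N" "N \<subseteq> M + span C"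
    using almost_subset_spanned[OF assms] by blast
  have "\<exists>w\<in>span C. x +o M = w +o M" if "x \<in> N" for x
  proof -
    obtain m w where "m \<in> M" "w \<in> span C" "x = m + w"
      using C(3) \<open>x \<in> N\<close> by (fastforce elim: set_plus_elim)
    then show ?thesis
      by (intro bexI[of _ w]) (auto simp: coset_eq_iff[OF assms(2)])
  qed
  \<comment> \<open>With \<open>C\<close> inside \<open>N\<close>, its span produces no coset
    outside \<open>N/M\<close>.\<close>
  moreover have "span C \<subseteq> N"
    using span_minimal[OF C(2) assms(1)] .
  ultimately have "quotient_space N M = quotient_space (span C) M"
    unfolding quotient_space_def by (metis (no_types, lifting) image_eqI image_subsetI
        subset_antisym subset_image_iff)
  then show "fin_dim_quotient scale N M"
    unfolding fin_dim_quotient_def using C by blast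
qed

end

section \<open>The algebraic core: a two-periodic complex X -> Y -> X up to finite rank\<close>

locale almost_complex =
  X: vector_space sX + Y: vector_space sY
  for sX :: "'k::field \<Rightarrow> 'a::ab_group_add \<Rightarrow> 'a" and sY :: "'k \<Rightarrow> 'b::ab_group_add \<Rightarrow> 'b" +
  fixes S T' :: "'a \<Rightarrow> 'b" and T S' :: "'b \<Rightarrow> 'a"
  assumes linear: "Vector_Spaces.linear sX sY S" "Vector_Spaces.linear sX sY T'"
      "Vector_Spaces.linear sY sX T" "Vector_Spaces.linear sY sX S'"
    and finite_rank_ST: "almost_subset sY (range (\<lambda>y. S (T y))) {0}"
    and finite_rank_TS: "almost_subset sX (range (\<lambda>x. T (S x))) {0}"
    and finite_rank_S: "almost_subset sY (range (\<lambda>x. S (S' (S x)) - S x)) {0}"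
    and finite_rank_T: "almost_subset sX (range (\<lambda>y. T (T' (T y)) - T y)) {0}"
begin

sublocale S: Vector_Spaces.linear sX sY S by (fact linear)
sublocale T': Vector_Spaces.linear sX sY T' by (fact linear)
sublocale T: Vector_Spaces.linear sY sX T by (fact linear)
sublocale S': Vector_Spaces.linear sY sX S' by (fact linear)

text \<open>The assumptions are symmetric under exchanging the spaces, so every fact proved below
  for one space holds for the other.\<close>

lemma swapped: "almost_complex sY sX T S' S T'"
  by (unfold_locales; (fact linear finite_rank_ST finite_rank_TS finite_rank_S finite_rank_T)?)

lemma subspace_null_space: "X.subspace (null_space S)"
  unfolding null_space_def by (rule S.subspace_kernel)

lemma subspace_range: "X.subspace (range T)"
  by (rule T.subspace_image) simp

text \<open>Rank-nullity for \<open>S\<close> on \<open>range T\<close>, where \<open>S\<close> has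
  finite rank. Half of the conditions on a Fredholm pair thus hold automatically.\<close>

lemma range_subset_null_space: "almost_subset sX (range T) (null_space S \<inter> range T)"
proof -
  have "almost_subset sX (range T) {x \<in> range T. S x \<in> {0}}"
    using finite_rank_ST
    by (intro S.almost_subset_vimage subspace_range) (auto simp: image_image)
  moreover have "{x \<in> range T. S x \<in> {0}} = null_space S \<inter> range T"
    by (auto simp: null_space_def)
  ultimately show ?thesis
    by simp
qed

text \<open>\<open>D\<close> has finite rank on the image of \<open>null_space S\<close> under
  \<open>1 - TT'\<close> and an almost trivial kernel, so this image is finite-dimensional; together
  with \<open>range T\<close> it covers \<open>null_space S\<close>. The map \<open>D\<close> is
  left open to serve both \<open>S'S + TT'\<close> and \<open>S + T'\<close>.\<close>

lemma null_space_subset_range_if: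
  fixes D :: "'a \<Rightarrow> 'c::ab_group_add"
  assumes "Vector_Spaces.linear sX sZ D" "almost_subset sX (null_space D) {0}"
    and "almost_subset sZ ((\<lambda>x. D (x - T (T' x))) ` null_space S) {0}"
  shows "almost_subset sX (null_space S) (range T)"
proof -
  interpret D: Vector_Spaces.linear sX sZ D by fact
  interpret XX: vector_space_pair sX sX ..
  have lin: "Vector_Spaces.linear sX sX (\<lambda>x. x - T (T' x))"
    by (unfold_locales) (auto simp: T.add T'.add T.scale T'.scale X.scale_right_diff_distrib)
  let ?W = "(\<lambda>x. x - T (T' x)) ` null_space S"
  have W: "X.subspace ?W"
    by (rule XX.linear_subspace_image[OF lin subspace_null_space])
  have "almost_subset sX ?W {x \<in> ?W. D x \<in> {0}}"
    using assms(3) by (intro D.almost_subset_vimage W) (auto simp: image_image)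
  moreover have "almost_subset sX {x \<in> ?W. D x \<in> {0}} {0}"
    using assms(2) by (rule X.almost_subset_mono) (auto simp: null_space_def)
  ultimately have "almost_subset sX ?W {0}"
    by (rule X.almost_subset_trans)
  then show ?thesis
  proof (rule X.almost_subset_zero_absorb[OF subspace_range])
    have "x = T (T' x) + (x - T (T' x))" for x
      by simp
    then show "null_space S \<subseteq> range T + ?W"
      by (metis (no_types, lifting) image_eqI rangeI set_plus_intro subsetI)
  qed
qed

text \<open>Since \<open>S\<close> is almost zero on \<open>W\<close>, the space \<open>W\<close>
  lies almost in \<open>null_space S\<close>, hence almost in \<open>range T\<close>. On
  \<open>range T\<close> the operator \<open>TT'\<close> is the identity up to finite rank, while
  \<open>TT'\<close> maps \<open>W\<close> into finite dimension.\<close>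

lemma almost_zero_if:
  assumes "almost_subset sX (null_space S) (range T)" "X.subspace W"
    and "almost_subset sY (S ` W) {0}" "almost_subset sX ((\<lambda>x. T (T' x)) ` W) {0}"
  shows "almost_subset sX W {0}"
proof -
  have "almost_subset sX W {x \<in> W. S x \<in> {0}}"
    using assms by (intro S.almost_subset_vimage) auto
  then have "almost_subset sX W (null_space S)"
    by (rule X.almost_subset_mono) (auto simp: null_space_def)
  then have "almost_subset sX W (range T)"
    using assms(1) by (rule X.almost_subset_trans)
  then have 1: "almost_subset sX W (W \<inter> range T)"
    by (intro X.almost_subset_Int assms subspace_range)
  have "almost_subset sX ((\<lambda>x. T (T' x)) ` W + uminus ` range (\<lambda>y. T (T' (T y)) - T y)) {0}"
  proof (intro X.almost_subset_zero_plus assms)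
    have "Vector_Spaces.linear sX sX uminus"
      by unfold_locales auto
    then show "almost_subset sX (uminus ` range (\<lambda>y. T (T' (T y)) - T y)) {0}"
      using finite_rank_T by (rule linear.almost_subset_image_zero)
  qed
  then have "almost_subset sX (W \<inter> range T) {0}"
  proof (rule X.almost_subset_mono)
    have "T y \<in> (\<lambda>x. T (T' x)) ` W + uminus ` range (\<lambda>y. T (T' (T y)) - T y)" if "T y \<in> W" for y
    proof -
      have "T y = T (T' (T y)) + - (T (T' (T y)) - T y)"
        by simp
      then show ?thesis
        using that by (metis (no_types, lifting) image_eqI rangeI set_plus_intro)
    qed
    then show "W \<inter> range T \<subseteq> (\<lambda>x. T (T' x)) ` W + uminus ` range (\<lambda>y. T (T' (T y)) - T y)"
      by blast
  qed simp
  with 1 show ?thesis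
    by (rule X.almost_subset_trans)
qed

text \<open>Split \<open>x\<close> as \<open>S'Sx + (x - S'Sx)\<close>. The second summand is mapped
  by \<open>S\<close> into a finite-dimensional space, so it lies almost in
  \<open>null_space S\<close> and therefore almost in \<open>range T\<close>.\<close>

lemma UNIV_almost_subset_if:
  assumes "almost_subset sX (null_space S) (range T)" "X.subspace L"
    and "almost_subset sX (range T) L" "almost_subset sX (range (\<lambda>x. S' (S x))) L"
  shows "almost_subset sX UNIV L"
proof -
  interpret XX: vector_space_pair sX sX ..
  let ?P = "\<lambda>x. x - S' (S x)"
  have "Vector_Spaces.linear sX sX ?P"
    by (unfold_locales) (auto simp: S.add S'.add S.scale S'.scale X.scale_right_diff_distrib)
  then have P: "X.subspace (range ?P)"
    by (rule XX.linear_subspace_image) simp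
  have "S ` range ?P = uminus ` range (\<lambda>x. S (S' (S x)) - S x)"
    by (auto simp: image_image S.diff)
  moreover have "Vector_Spaces.linear sY sY uminus"
    by unfold_locales auto
  ultimately have "almost_subset sY (S ` range ?P) {0}"
    using finite_rank_S linear.almost_subset_image_zero by fastforce
  then have "almost_subset sX (range ?P) {x \<in> range ?P. S x \<in> {0}}"
    by (intro S.almost_subset_vimage P) auto
  then have "almost_subset sX (range ?P) (null_space S)"
    by (rule X.almost_subset_mono) (auto simp: null_space_def)
  then have "almost_subset sX (range ?P) L"
    using assms X.almost_subset_trans by blast
  then have "almost_subset sX (range (\<lambda>x. S' (S x)) + range ?P) L"
    by (intro X.almost_subset_plus assms)
  moreover have "x \<in> range (\<lambda>x. S' (S x)) + range ?P" for x
  proof -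
    have "x = S' (S x) + ?P x" by simp
    then show ?thesis by (metis (no_types, lifting) rangeI set_plus_intro)
  qed
  ultimately show ?thesis
    by (metis X.almost_subset_mono order_refl subsetI)
qed

lemma linear_sum: "Vector_Spaces.linear sX sX (\<lambda>x. S' (S x) + T (T' x))"
  by unfold_locales (auto simp: S.add S'.add T.add T'.add S.scale S'.scale T.scale T'.scale
      X.scale_right_distrib algebra_simps)

text \<open>Applying \<open>S\<close> to \<open>S'Sx + TT'x = 0\<close> shows that \<open>Sx\<close>
  ranges over finite dimension; then so does \<open>TT'x = -S'Sx\<close>.\<close>

lemma null_space_sum_almost_zero:
  assumes "almost_subset sX (null_space S) (range T)"
  shows "almost_subset sX (null_space (\<lambda>x. S' (S x) + T (T' x))) {0}"
proof -
  define W where "W = null_space (\<lambda>x. S' (S x) + T (T' x))"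
  have W_iff: "x \<in> W \<longleftrightarrow> S' (S x) + T (T' x) = 0" for x
    by (simp add: W_def null_space_def)
  have minus_mem: "- x \<in> W" if "x \<in> W" for x
    using that by (simp add: W_iff S.neg S'.neg T.neg T'.neg minus_unique)
  have "X.subspace W"
    unfolding W_def null_space_def
    by (rule module_hom.subspace_kernel) (use linear_sum in \<open>simp add: module_hom_iff_linear\<close>)
  moreover have S_W: "almost_subset sY (S ` W) {0}"
  proof (rule Y.almost_subset_mono[OF Y.almost_subset_zero_plus[OF finite_rank_S finite_rank_ST]])
    show "S ` W \<subseteq> range (\<lambda>x. S (S' (S x)) - S x) + range (\<lambda>y. S (T y))"
    proof clarify
      fix x assume "x \<in> W"
      then have "S (S' (S x) + T (T' x)) = 0"
        by (simp add: W_iff S.zero)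
      \<comment> \<open>The argument \<open>-x\<close> corrects the sign: the error set is the range
        of \<open>SS'S - S\<close>, but \<open>S - SS'S\<close> occurs here.\<close>
      then have "S x = (S (S' (S (- x))) - S (- x)) + S (T (T' (- x)))"
        by (simp add: S.add S.neg S'.neg T.neg T'.neg algebra_simps)
      then show "S x \<in> range (\<lambda>x. S (S' (S x)) - S x) + range (\<lambda>y. S (T y))"
        by (metis (no_types, lifting) rangeI set_plus_intro)
    qed
  qed simp
  moreover have "almost_subset sX ((\<lambda>x. T (T' x)) ` W) {0}"
  proof (rule X.almost_subset_mono[OF S'.almost_subset_image_zero[OF S_W]])
    show "(\<lambda>x. T (T' x)) ` W \<subseteq> S' ` S ` W"
    proof clarify
      fix x assume x: "x \<in> W"
      then have "T (T' x) = S' (S (- x))"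
        by (simp add: W_iff S.neg S'.neg minus_unique)
      then show "T (T' x) \<in> S' ` S ` W"
        using minus_mem[OF x] by simp
    qed
  qed simp
  ultimately show ?thesis
    using almost_zero_if[OF assms] by (simp add: W_def)
qed

text \<open>For \<open>x\<close> in \<open>null_space S\<close>, the operator sends
  \<open>x - TT'x\<close> to \<open>-S'STT'x - (TT'T - T)T'x\<close>, a finite-rank
  expression.\<close>

lemma null_space_subset_range_if_sum:
  assumes "almost_subset sX (null_space (\<lambda>x. S' (S x) + T (T' x))) {0}"
  shows "almost_subset sX (null_space S) (range T)"
proof (rule null_space_subset_range_if[OF linear_sum assms])
  let ?D = "\<lambda>x. S' (S (x - T (T' x))) + T (T' (x - T (T' x)))"
  show "almost_subset sX (?D ` null_space S) {0}"
  proof (rule X.almost_subset_mono[OF X.almost_subset_zero_plus[OF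
          S'.almost_subset_image_zero[OF finite_rank_ST] finite_rank_T]])
    show "?D ` null_space S \<subseteq> S' ` range (\<lambda>y. S (T y)) + range (\<lambda>y. T (T' (T y)) - T y)"
    proof clarify
      fix x assume "x \<in> null_space S"
      then have "?D x = S' (S (T (T' (- x)))) + (T (T' (T (T' (- x)))) - T (T' (- x)))"
        by (simp add: null_space_def S.neg S'.neg T.neg T'.neg S.diff S'.diff T.diff T'.diff)
      then show "?D x \<in> S' ` range (\<lambda>y. S (T y)) + range (\<lambda>y. T (T' (T y)) - T y)"
        by (metis (no_types, lifting) rangeI image_eqI set_plus_intro)
    qed
  qed simp
qed

lemma UNIV_almost_subset_range_sum:
  assumes "almost_subset sX (null_space S) (range T)"
  shows "almost_subset sX UNIV (range (\<lambda>x. S' (S x) + T (T' x)))"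
proof (rule UNIV_almost_subset_if[OF assms])
  interpret XX: vector_space_pair sX sX ..
  let ?A = "\<lambda>x. S' (S x) + T (T' x)"
  show A: "X.subspace (range ?A)"
    by (rule XX.linear_subspace_image[OF linear_sum]) simp
  let ?F = "S' ` range (\<lambda>y. S (T y)) + range (\<lambda>y. T (T' (T y)) - T y)"
  have F: "almost_subset sX ?F {0}"
    by (intro X.almost_subset_zero_plus S'.almost_subset_image_zero finite_rank_ST finite_rank_T)
  have mem_F: "S' (S (T y)) + (T (T' (T y)) - T y) \<in> ?F" for y
    by blast
  show "almost_subset sX (range T) (range ?A)"
  proof (rule X.almost_subset_zero_absorb[OF A F], clarify)
    fix y
    have "T y = ?A (T y) + (S' (S (T (- y))) + (T (T' (T (- y))) - T (- y)))"
      by (simp add: S.neg S'.neg T.neg T'.neg)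
    moreover have "\<dots> \<in> range ?A + ?F"
      by (rule set_plus_intro[OF rangeI mem_F])
    ultimately show "T y \<in> range ?A + ?F"
      by (simp only:)
  qed
  show "almost_subset sX (range (\<lambda>x. S' (S x))) (range ?A)"
  proof (rule X.almost_subset_zero_absorb[OF A F], clarify)
    fix x
    \<comment> \<open>Subtracting \<open>TT'x\<close> from the argument cancels the unwanted term
      \<open>TT'x\<close> of \<open>?A x\<close> up to finite rank.\<close>
    have "S' (S x) = ?A (x - T (T' x)) + (S' (S (T (T' x))) + (T (T' (T (T' x))) - T (T' x)))"
      by (simp add: S.diff S'.diff T.diff T'.diff)
    moreover have "\<dots> \<in> range ?A + ?F"
      by (rule set_plus_intro[OF rangeI mem_F])
    ultimately show "S' (S x) \<in> range ?A + ?F"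
      by (simp only:)
  qed
qed

section \<open>The blocks of \<open>V\<close>: null space and range of \<open>S + T'\<close>\<close>

lemma linear_diagonal: "Vector_Spaces.linear sX sY (\<lambda>x. S x + T' x)"
  by unfold_locales (auto simp: S.add T'.add S.scale T'.scale Y.scale_right_distrib algebra_simps)

text \<open>Reflexivity of \<open>T'\<close> up to finite rank. It allows control of
  \<open>TT'x\<close> to be turned into control of \<open>T'x\<close>, which \<open>S + T'\<close>
  contains without a factor \<open>T\<close>.\<close>

context
  assumes finite_rank_T': "almost_subset sY (range (\<lambda>x. T' (T (T' x)) - T' x)) {0}"
begin

text \<open>From \<open>Sx = -T'x\<close> follows \<open>TT'x = -TSx\<close>, of finite rank.
  Reflexivity then bounds \<open>T'x\<close>, hence also \<open>Sx\<close>.\<close>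

lemma null_space_diagonal_almost_zero:
  assumes "almost_subset sX (null_space S) (range T)"
  shows "almost_subset sX (null_space (\<lambda>x. S x + T' x)) {0}"
proof (rule almost_zero_if[OF assms])
  let ?W = "null_space (\<lambda>x. S x + T' x)"
  show "X.subspace ?W"
    unfolding null_space_def by (rule module_hom.subspace_kernel)
      (use linear_diagonal in \<open>simp add: module_hom_iff_linear\<close>)
  have TT': "T (T' x) = T (S (- x))" if "x \<in> ?W" for x
  proof -
    have "T (S x + T' x) = 0"
      using that by (simp add: null_space_def T.zero)
    then show ?thesis
      by (simp add: T.add T.neg S.neg eq_neg_iff_add_eq_0 add.commute)
  qed
  show "almost_subset sX ((\<lambda>x. T (T' x)) ` ?W) {0}"
    by (rule X.almost_subset_mono[OF finite_rank_TS]) (auto simp: TT')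
  show "almost_subset sY (S ` ?W) {0}"
  proof (rule Y.almost_subset_mono[OF Y.almost_subset_zero_plus[OF
          T'.almost_subset_image_zero[OF finite_rank_TS] finite_rank_T']])
    show "S ` ?W \<subseteq> T' ` range (\<lambda>x. T (S x)) + range (\<lambda>x. T' (T (T' x)) - T' x)"
    proof clarify
      fix x assume x: "x \<in> ?W"
      then have "S x = - T' x"
        by (simp add: null_space_def eq_neg_iff_add_eq_0)
      then have "S x = T' (T (S x)) + (T' (T (T' x)) - T' x)"
        using TT'[OF x] by (simp add: S.neg T.neg T'.neg)
      then show "S x \<in> T' ` range (\<lambda>x. T (S x)) + range (\<lambda>x. T' (T (T' x)) - T' x)"
        by (metis (no_types, lifting) rangeI image_eqI set_plus_intro)
    qed
  qed simp
qed

lemma null_space_subset_range_if_diagonal: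
  assumes "almost_subset sX (null_space (\<lambda>x. S x + T' x)) {0}"
  shows "almost_subset sX (null_space S) (range T)"
proof (rule null_space_subset_range_if[OF linear_diagonal assms])
  let ?D = "\<lambda>x. S (x - T (T' x)) + T' (x - T (T' x))"
  show "almost_subset sY (?D ` null_space S) {0}"
  proof (rule Y.almost_subset_mono[OF Y.almost_subset_zero_plus[OF finite_rank_ST finite_rank_T']])
    show "?D ` null_space S \<subseteq> range (\<lambda>y. S (T y)) + range (\<lambda>x. T' (T (T' x)) - T' x)"
    proof clarify
      fix x assume "x \<in> null_space S"
      then have "?D x = S (T (T' (- x))) + (T' (T (T' (- x))) - T' (- x))"
        by (simp add: null_space_def S.neg T.neg T'.neg S.diff T'.diff)
      then show "?D x \<in> range (\<lambda>y. S (T y)) + range (\<lambda>x. T' (T (T' x)) - T' x)"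
        by (metis (no_types, lifting) rangeI set_plus_intro)
    qed
  qed simp
qed

text \<open>The range lies in Y, so the hypothesis is the one on \<open>null_space T\<close>, and
  the covering argument is used with the spaces exchanged. Up to finite rank, \<open>Sx\<close> is
  the value at \<open>x - TT'x\<close> and \<open>T'Ty\<close> the value at
  \<open>Ty\<close>.\<close>

lemma UNIV_almost_subset_range_diagonal:
  assumes "almost_subset sY (null_space T) (range S)"
  shows "almost_subset sY UNIV (range (\<lambda>x. S x + T' x))"
proof (rule almost_complex.UNIV_almost_subset_if[OF swapped assms])
  interpret XY: vector_space_pair sX sY ..
  let ?U = "\<lambda>x. S x + T' x"
  show U: "Y.subspace (range ?U)"
    by (rule XY.linear_subspace_image[OF linear_diagonal]) simp
  show "almost_subset sY (range S) (range ?U)"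
  proof (rule Y.almost_subset_zero_absorb[OF U
        Y.almost_subset_zero_plus[OF finite_rank_ST finite_rank_T']], clarify)
    fix x
    have "S x = ?U (x - T (T' x)) + (S (T (T' x)) + (T' (T (T' x)) - T' x))"
      by (simp add: S.diff T'.diff)
    moreover have "\<dots> \<in> range ?U + (range (\<lambda>y. S (T y)) + range (\<lambda>x. T' (T (T' x)) - T' x))"
      by (intro set_plus_intro rangeI)
    ultimately show "S x \<in> range ?U + (range (\<lambda>y. S (T y)) + range (\<lambda>x. T' (T (T' x)) - T' x))"
      by (simp only:)
  qed
  show "almost_subset sY (range (\<lambda>y. T' (T y))) (range ?U)"
  proof (rule Y.almost_subset_zero_absorb[OF U finite_rank_ST], clarify)
    fix y
    have "T' (T y) = ?U (T y) + S (T (- y))"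
      by (simp add: S.neg T.neg)
    moreover have "\<dots> \<in> range ?U + range (\<lambda>y. S (T y))"
      by (intro set_plus_intro rangeI)
    ultimately show "T' (T y) \<in> range ?U + range (\<lambda>y. S (T y))"
      by (simp only:)
  qed
qed

end

end

section \<open>Fredholm operators and pairs as inclusions modulo finite dimension\<close>

lemma bounded_ops_imp_linear:
  assumes "vector_space sX" "vector_space sY" "A \<in> bounded_ops sX sY"
  shows "Vector_Spaces.linear sX sY A"
proof -
  have "bounded_linear A" and "\<And>c x. A (sX c x) = sY c (A x)"
    using assms(3) unfolding bounded_ops_def by blast+
  moreover from this(1) have "A (x + y) = A x + A y" for x y
    by (rule linear_simps(1))
  ultimately show ?thesis
    unfolding Vector_Spaces.linear_iff using assms(1,2) by blast
qed

lemma fredholm_op_iff: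
  assumes "vector_space s"
  shows "fredholm_op s A \<longleftrightarrow> A \<in> bounded_ops s s \<and>
    almost_subset s (null_space A) {0} \<and> almost_subset s UNIV (range A)"
proof (cases "A \<in> bounded_ops s s")
  case True
  interpret vector_space s by fact
  interpret A: Vector_Spaces.linear s s A
    using assms assms True by (rule bounded_ops_imp_linear)
  have "subspace (null_space A)" "subspace (range A)"
    unfolding null_space_def by (rule A.subspace_kernel, rule A.subspace_image, simp)
  then show ?thesis
    unfolding fredholm_op_def
    by (simp add: fin_dim_iff_almost_subset fin_dim_quotient_iff_almost_subset)
qed (simp add: fredholm_op_def)

lemma (in almost_complex) fin_dim_quotient_null_space_iff:
  "fin_dim_quotient sX (null_space S) (null_space S \<inter> range T) \<and>
   fin_dim_quotient sX (range T) (null_space S \<inter> range T) \<longleftrightarrow>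
   almost_subset sX (null_space S) (range T)"
proof -
  have "X.subspace (null_space S \<inter> range T)"
    by (intro X.subspace_inter subspace_null_space subspace_range)
  then have "fin_dim_quotient sX (null_space S) (null_space S \<inter> range T) \<longleftrightarrow>
      almost_subset sX (null_space S) (null_space S \<inter> range T)"
    and "fin_dim_quotient sX (range T) (null_space S \<inter> range T)"
    using range_subset_null_space
    by (simp_all add: X.fin_dim_quotient_iff_almost_subset subspace_null_space subspace_range)
  moreover have "almost_subset sX (null_space S) (null_space S \<inter> range T) \<longleftrightarrow>
      almost_subset sX (null_space S) (range T)"
    using X.almost_subset_Int[OF subspace_null_space subspace_range]
      X.almost_subset_mono[of "null_space S" "null_space S \<inter> range T" "null_space S" "range T"]
    by blast
  ultimately show ?thesis
    by blast
qed

section \<open>Products of two vector spaces\<close>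

context vector_space_prod
begin

lemma almost_subset_Times:
  assumes "almost_subset s1 A C" "almost_subset s2 B D" "0 \<in> C" "0 \<in> D"
  shows "almost_subset scale (A \<times> B) (C \<times> D)"
proof -
  have "Vector_Spaces.linear s1 scale (\<lambda>x. (x, 0))" "Vector_Spaces.linear s2 scale (\<lambda>y. (0, y))"
    by (unfold_locales; simp add: scale_prod)+
  then have "almost_subset scale ((\<lambda>x. (x, 0)) ` A + (\<lambda>y. (0, y)) ` B)
      ((\<lambda>x. (x, 0)) ` C + (\<lambda>y. (0, y)) ` D)"
    using assms by (intro p.almost_subset_set_plus linear.almost_subset_image)
  then show ?thesis
    by (rule p.almost_subset_mono) (force simp: set_plus_def image_iff)+
qed

text \<open>Project to the factors; the zeros keep both factors nonempty, so the projections of the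
  product are all of \<open>A\<close> and \<open>B\<close>.\<close>

lemma almost_zero_TimesD:
  assumes "almost_subset scale (A \<times> B) {0}" "0 \<in> A" "0 \<in> B"
  shows "almost_subset s1 A {0}" "almost_subset s2 B {0}"
proof -
  have "Vector_Spaces.linear scale s1 fst" "Vector_Spaces.linear scale s2 snd"
    by (unfold_locales; simp add: scale_def)+
  from this[THEN linear.almost_subset_image_zero, OF assms(1)]
  show "almost_subset s1 A {0}" "almost_subset s2 B {0}"
    using assms(2,3) by (simp_all split: if_splits)
qed

end

section \<open>Extensions are generalized inverses up to finite rank\<close>

lemma fin_dim_imp_subspace:
  assumes "vector_space s" "fin_dim s W"
  shows "module.subspace s W"
proof -
  interpret vector_space s by fact
  show ?thesis
    using assms(2) by (auto simp: fin_dim_def)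
qed

text \<open>\<open>A'\<close> is prescribed only on \<open>Y0\<close>, where it lifts
  \<open>G\<close> modulo \<open>M\<close>. Its arbitrary values on \<open>N\<close> contribute at
  most the image of \<open>N\<close>.\<close>

lemma extension_diff_mem:
  assumes X: "vector_space sX" "module.subspace sX M" "closed_complement sX M X0"
    and Y: "vector_space sY" "module.subspace sY N" "closed_complement sY N Y0"
    and ext: "extension_of sX M X0 sY N Y0 G A'"
    and u: "G (y +o N) = u +o M"
  shows "A' y - u \<in> A' ` N + M"
proof -
  interpret X: vector_space sX by fact
  interpret Y: vector_space sY by fact
  interpret A': Vector_Spaces.linear sY sX A'
    using ext by (intro bounded_ops_imp_linear X Y) (simp add: extension_of_def)
  have "y \<in> N + Y0" "u \<in> M + X0"
    using X Y by (auto simp: closed_complement_def)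
  then obtain n y0 m x0 where
    y: "n \<in> N" "y0 \<in> Y0" "y = n + y0" and x0: "m \<in> M" "x0 \<in> X0" "u = m + x0"
    by (auto elim!: set_plus_elim)
  \<comment> \<open>Passing from \<open>u\<close> to \<open>x0\<close> shows that the coset has a
    representative in \<open>X0\<close>, so \<open>inv_into\<close> returns a true preimage.\<close>
  have "y +o N = y0 +o N" "u +o M = x0 +o M"
    using y x0 by (simp_all add: X.coset_eq_iff[OF X(2)] Y.coset_eq_iff[OF Y(2)])
  then have G: "G (y0 +o N) = u +o M" "G (y0 +o N) \<in> (\<lambda>x. x +o M) ` X0"
    using u x0(2) by auto
  have "A' y0 +o M = G (y0 +o N)"
    using ext y(2) f_inv_into_f[OF G(2)] by (simp add: extension_of_def)
  then have "A' y0 - u \<in> M"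
    using G(1) X.coset_eq_iff[OF X(2)] by simp
  moreover have "A' y - u = A' n + (A' y0 - u)"
    by (simp add: y(3) A'.add)
  ultimately show ?thesis
    using y(1) by (metis image_eqI set_plus_intro)
qed

context
  fixes sX :: "'k::real_normed_field \<Rightarrow> 'a::real_normed_vector \<Rightarrow> 'a"
    and sY :: "'k \<Rightarrow> 'b::real_normed_vector \<Rightarrow> 'b"
    and M X0 :: "'a set" and N Y0 :: "'b set"
    and A :: "'a \<Rightarrow> 'b" and A' :: "'b \<Rightarrow> 'a" and F :: "'a set \<Rightarrow> 'b set" and G :: "'b set \<Rightarrow> 'a set"
  assumes X: "vector_space sX" "fin_dim sX M" "closed_complement sX M X0"
    and Y: "vector_space sY" "fin_dim sY N" "closed_complement sY N Y0"
    and A: "A \<in> bounded_ops sX sY"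
    and induced: "induced_op sX M sY N A F"
    and ext: "extension_of sX M X0 sY N Y0 G A'"
begin

interpretation X: vector_space sX by (fact X)
interpretation Y: vector_space sY by (fact Y)
interpretation A: Vector_Spaces.linear sX sY A
  using A by (intro bounded_ops_imp_linear X Y)
interpretation A': Vector_Spaces.linear sY sX A'
  using ext by (intro bounded_ops_imp_linear X Y) (simp add: extension_of_def)

lemma M_almost_zero: "almost_subset sX M {0}"
  using X.fin_dim_iff_almost_subset[OF fin_dim_imp_subspace[OF X(1,2)]] X(2) by blast

lemma N_almost_zero: "almost_subset sY N {0}"
  using Y.fin_dim_iff_almost_subset[OF fin_dim_imp_subspace[OF Y(1,2)]] Y(2) by blast

lemma defect_almost_zero: "almost_subset sX (A' ` N + M) {0}"
  by (intro X.almost_subset_zero_plus A'.almost_subset_image_zero M_almost_zero N_almost_zero)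

text \<open>Let \<open>v\<close> represent \<open>G (A x +o N)\<close>. Then \<open>A'Ax - v\<close>
  is a lifting defect, and \<open>FGF = F\<close> puts \<open>Av - Ax\<close> into
  \<open>N\<close>.\<close>

lemma extension_finite_rank:
  assumes "quotient_generalized_inverse sX M sY N F G"
  shows "almost_subset sY (range (\<lambda>x. A (A' (A x)) - A x)) {0}"
proof -
  have "almost_subset sY (A ` (A' ` N + M) + N) {0}"
    by (intro Y.almost_subset_zero_plus A.almost_subset_image_zero defect_almost_zero N_almost_zero)
  moreover have "A (A' (A x)) - A x \<in> A ` (A' ` N + M) + N" for x
  proof -
    have Fx: "F (x +o M) = A x +o N" for x
      using induced by (simp add: induced_op_def)
    have "G (A x +o N) \<in> quotient_space UNIV M"
      using assms
      by (auto simp: quotient_generalized_inverse_def bounded_quotient_ops_def quotient_space_def)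
    then obtain v where v: "G (A x +o N) = v +o M"
      by (auto simp: quotient_space_def)
    have "F (x +o M) = F (G (F (x +o M)))"
      using assms by (simp add: quotient_generalized_inverse_def quotient_space_def)
    then have "A v - A x \<in> N"
      by (simp add: Fx v eq_commute Y.coset_eq_iff[OF fin_dim_imp_subspace[OF Y(1,2)], symmetric])
    moreover have "A' (A x) - v \<in> A' ` N + M"
      using extension_diff_mem[OF X(1) fin_dim_imp_subspace[OF X(1,2)] X(3)
          Y(1) fin_dim_imp_subspace[OF Y(1,2)] Y(3) ext v] .
    moreover have "A (A' (A x)) - A x = A (A' (A x) - v) + (A v - A x)"
      by (simp add: A.diff)
    ultimately show ?thesis
      by (metis (no_types, lifting) image_eqI set_plus_intro)
  qed
  ultimately show ?thesis
    by (meson Y.almost_subset_mono image_subsetI order_refl)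
qed

text \<open>Let \<open>v\<close> represent \<open>G (y +o N)\<close>. By \<open>GFG = G\<close> it
  also represents \<open>G (A v +o N)\<close>, so \<open>A'y - v\<close> and \<open>A'Av - v\<close>
  are both lifting defects; these two determine \<open>A'AA'y - A'y\<close>.\<close>

lemma extension_finite_rank_reflexive:
  assumes "quotient_generalized_inverse sX M sY N F G"
    and "quotient_generalized_inverse sY N sX M G F"
  shows "almost_subset sX (range (\<lambda>y. A' (A (A' y)) - A' y)) {0}"
proof -
  let ?F = "A' ` N + M"
  interpret XX: vector_space_pair sX sX ..
  have lin: "Vector_Spaces.linear sX sX (\<lambda>w. A' (A w) - w)"
    by unfold_locales (auto simp: A.add A'.add A.scale A'.scale X.scale_right_diff_distrib)
  have "almost_subset sX (?F + (\<lambda>w. A' (A w) - w) ` ?F) {0}"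
    by (intro X.almost_subset_zero_plus linear.almost_subset_image_zero[OF lin] defect_almost_zero)
  moreover have "A' (A (A' y)) - A' y \<in> ?F + (\<lambda>w. A' (A w) - w) ` ?F" for y
  proof -
    have Fx: "F (x +o M) = A x +o N" for x
      using induced by (simp add: induced_op_def)
    have diff_mem: "A' y - u \<in> ?F" if "G (y +o N) = u +o M" for y u
      using extension_diff_mem[OF X(1) fin_dim_imp_subspace[OF X(1,2)] X(3)
          Y(1) fin_dim_imp_subspace[OF Y(1,2)] Y(3) ext that] .
    have "G (y +o N) \<in> quotient_space UNIV M"
      using assms(1)
      by (auto simp: quotient_generalized_inverse_def bounded_quotient_ops_def quotient_space_def)
    then obtain v where v: "G (y +o N) = v +o M"
      by (auto simp: quotient_space_def)
    have "G (y +o N) = G (F (G (y +o N)))"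
      using assms(2) by (simp add: quotient_generalized_inverse_def quotient_space_def)
    then have "G (A v +o N) = v +o M"
      by (simp add: Fx v)
    from diff_mem[OF this] diff_mem[OF v]
    have "A' (A v) - v \<in> ?F" "A' y - v \<in> ?F" .
    moreover have "A' (A (A' y)) - A' y
        = (A' (A v) - v) + (A' (A (A' y - v)) - (A' y - v))"
      by (simp add: A.diff A'.diff)
    ultimately show ?thesis
      by (metis (no_types, lifting) image_eqI set_plus_intro)
  qed
  ultimately show ?thesis
    by (meson X.almost_subset_mono image_subsetI order_refl)
qed

end

section \<open>Reduction of all three statements to one algebraic criterion\<close>

theorem theorem3p6:
  fixes sX :: "'k::real_normed_field \<Rightarrow> 'a::banach \<Rightarrow> 'a"
    and sY :: "'k \<Rightarrow> 'b::banach \<Rightarrow> 'b"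
    and S T' :: "'a \<Rightarrow> 'b" and T S' :: "'b \<Rightarrow> 'a"
    and M X0 :: "'a set" and N Y0 :: "'b set"
    and St Tt' :: "'a set \<Rightarrow> 'b set" and Tt St' :: "'b set \<Rightarrow> 'a set"
    and V :: "'a \<times> 'b \<Rightarrow> 'a \<times> 'b"
  assumes "banach_space_over sX" and "banach_space_over sY"
    and "regular_op sX sY S" and "regular_op sY sX T"
    and "M = range (T \<circ> S)" and "N = range (S \<circ> T)"
    and "fin_dim sX M" and "fin_dim sY N"
    and "induced_op sX M sY N S St" and "induced_op sY N sX M T Tt"
    and "quotient_generalized_inverse sX M sY N St St'"
    and "quotient_generalized_inverse sY N sX M Tt Tt'"
    and "closed_complement sX M X0" and "closed_complement sY N Y0"
    and "extension_of sX M X0 sY N Y0 St' S'"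
    and "extension_of sY N Y0 sX M X0 Tt' T'"
    and "V = (\<lambda>(x, y). (T y + S' y, S x + T' x))"
  shows
    "(regular_fredholm_pair sX sY S T \<longleftrightarrow>
        fredholm_op sX (\<lambda>x. S' (S x) + T (T' x)) \<and> fredholm_op sY (\<lambda>y. T' (T y) + S (S' y))) \<and>
     (quotient_generalized_inverse sY N sX M St' St \<and>
      quotient_generalized_inverse sX M sY N Tt' Tt \<longrightarrow>
       (regular_fredholm_pair sX sY S T \<longleftrightarrow> fredholm_op (module_prod.scale sX sY) V))"
proof -
  have X: "vector_space sX" and Y: "vector_space sY"
    using assms(1,2) by (auto simp: banach_space_over_def)
  interpret X: vector_space sX by (fact X)
  interpret Y: vector_space sY by (fact Y)
  have bounded: "S \<in> bounded_ops sX sY" "T' \<in> bounded_ops sX sY"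
      "T \<in> bounded_ops sY sX" "S' \<in> bounded_ops sY sX"
    using assms by (auto simp: regular_op_def extension_of_def)
  then have bl: "bounded_linear S" "bounded_linear T'" "bounded_linear T" "bounded_linear S'"
    by (auto simp: bounded_ops_def)
  \<comment> \<open>The first two facts still await the generalized inverse hypotheses, the last two
    await reflexivity, which is available only for \<open>V\<close>.\<close>
  note finite_rank =
    extension_finite_rank[OF X assms(7,13) Y assms(8,14) bounded(1) assms(9,15)]
    extension_finite_rank[OF Y assms(8,14) X assms(7,13) bounded(3) assms(10,16)]
    extension_finite_rank_reflexive[OF X assms(7,13) Y assms(8,14) bounded(1) assms(9,15,11)]
    extension_finite_rank_reflexive[OF Y assms(8,14) X assms(7,13) bounded(3) assms(10,16,12)]
  have "almost_subset sX M {0}" "almost_subset sY N {0}"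
    using assms(7,8) X.fin_dim_iff_almost_subset[OF fin_dim_imp_subspace[OF X]]
      Y.fin_dim_iff_almost_subset[OF fin_dim_imp_subspace[OF Y]] by blast+
  then have "almost_subset sY (range (\<lambda>y. S (T y))) {0}" "almost_subset sX (range (\<lambda>x. T (S x))) {0}"
    by (simp_all add: assms(5,6) comp_def)
  then interpret P: almost_complex sX sY S T' T S'
    by (intro almost_complex.intro almost_complex_axioms.intro X Y finite_rank(1)[OF assms(11)]
        finite_rank(2)[OF assms(12)] bounded_ops_imp_linear[OF X Y] bounded_ops_imp_linear[OF Y X]
        bounded)
  interpret Q: almost_complex sY sX T S' S T'
    by (fact P.swapped)
  \<comment> \<open>Exactness up to finite dimension at both spaces, the common criterion.\<close>
  let ?exact = "almost_subset sX (null_space S) (range T) \<and> almost_subset sY (null_space T) (range S)"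
  have i: "regular_fredholm_pair sX sY S T \<longleftrightarrow> ?exact"
    using assms(3,4) bounded P.fin_dim_quotient_null_space_iff Q.fin_dim_quotient_null_space_iff
    by (auto simp: regular_fredholm_pair_def fredholm_pair_def)
  have "(\<lambda>x. S' (S x) + T (T' x)) \<in> bounded_ops sX sX"
      "(\<lambda>y. T' (T y) + S (S' y)) \<in> bounded_ops sY sY"
    using bl P.linear_sum Q.linear_sum
    by (auto simp: bounded_ops_def Vector_Spaces.linear_iff
        intro!: bounded_linear_add intro: bounded_linear_compose)
  then have ii: "fredholm_op sX (\<lambda>x. S' (S x) + T (T' x)) \<and>
      fredholm_op sY (\<lambda>y. T' (T y) + S (S' y)) \<longleftrightarrow> ?exact"
    unfolding fredholm_op_iff[OF X] fredholm_op_iff[OF Y]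
    using P.null_space_sum_almost_zero P.null_space_subset_range_if_sum P.UNIV_almost_subset_range_sum
      Q.null_space_sum_almost_zero Q.null_space_subset_range_if_sum Q.UNIV_almost_subset_range_sum
    by blast
  have iii: "fredholm_op (module_prod.scale sX sY) V \<longleftrightarrow> ?exact"
    if "quotient_generalized_inverse sY N sX M St' St" "quotient_generalized_inverse sX M sY N Tt' Tt"
  proof -
    note T' = finite_rank(4)[OF that(2)] and S' = finite_rank(3)[OF that(1)]
    interpret XY: vector_space_prod sX sY ..
    let ?U = "\<lambda>x. S x + T' x" and ?W = "\<lambda>y. T y + S' y"
    have V: "V = (\<lambda>p. (?W (snd p), ?U (fst p)))"
      by (simp add: assms(17) case_prod_beta fun_eq_iff)
    have "bounded_linear V"
      unfolding V using bl by (intro bounded_linear_Pair bounded_linear_add)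
        (auto intro: bounded_linear_compose bounded_linear_fst bounded_linear_snd)
    then have V_bounded: "V \<in> bounded_ops XY.scale XY.scale"
      using P.linear_diagonal Q.linear_diagonal
      by (auto simp: bounded_ops_def V XY.scale_def Vector_Spaces.linear_iff)
    \<comment> \<open>\<open>V\<close> exchanges the summands: its null space has the order
      \<open>?U\<close>, \<open>?W\<close>, its range the order \<open>?W\<close>,
      \<open>?U\<close>.\<close>
    have null: "null_space V = null_space ?U \<times> null_space ?W"
      by (auto simp: V null_space_def zero_prod_def)
    have range: "range V = range ?W \<times> range ?U"
      by (force simp: V image_iff)
    have zero: "0 \<in> null_space ?U" "0 \<in> null_space ?W" "0 \<in> range ?U" "0 \<in> range ?W"
      by (auto simp: null_space_def P.S.zero P.S'.zero P.T.zero P.T'.zero image_iff intro!: exI[of _ 0])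
    show ?thesis
    proof
      assume "fredholm_op XY.scale V"
      then have "almost_subset XY.scale (null_space ?U \<times> null_space ?W) {0}"
        by (simp add: fredholm_op_iff[OF XY.p.vector_space_axioms] null)
      from XY.almost_zero_TimesD[OF this zero(1,2)] show ?exact
        using P.null_space_subset_range_if_diagonal[OF T']
          Q.null_space_subset_range_if_diagonal[OF S'] by blast
    next
      assume ?exact
      then have "almost_subset sX (null_space ?U) {0}" "almost_subset sY (null_space ?W) {0}"
        "almost_subset sX UNIV (range ?W)" "almost_subset sY UNIV (range ?U)"
        using P.null_space_diagonal_almost_zero[OF T'] Q.null_space_diagonal_almost_zero[OF S']
          P.UNIV_almost_subset_range_diagonal[OF T'] Q.UNIV_almost_subset_range_diagonal[OF S']
        by blast+
      then have "almost_subset XY.scale (null_space V) ({0} \<times> {0})"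
        "almost_subset XY.scale (UNIV \<times> UNIV) (range V)"
        unfolding null range by (intro XY.almost_subset_Times zero singletonI; simp)+
      then show "fredholm_op XY.scale V"
        using V_bounded by (simp add: fredholm_op_iff[OF XY.p.vector_space_axioms] zero_prod_def)
    qed
  qed
  show ?thesis
    using i ii iii by blast
qed

end
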